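(* Let $\bar{\mathbb R}=\mathrm{Hom}[\mathbb R,T]$ be the Bohr compactification of the line and $\mu_0$ its normalized Haar measure. Then $\mu_0$ is ergodic with respect to the action of the multiplicative group $\mathbb R\setminus\{0\}$ on $\bar{\mathbb R}$ given by $(\lambda,\bar x)\mapsto\lambda^*\bar x$, where $$\lambda^*\bar x(k):=\bar x(\lambda k),\qquad k\in\mathbb R,\ \lambda\in\mathbb R\setminus\{0\}.$$
   Context: $T$ is the multiplicative group of complex numbers of modulus one. $\bar{\mathbb R}=\mathrm{Hom}[\mathbb R,T]$ is the set of all (not necessarily continuous) group morphisms from $(\mathbb R,+)$ to $T$, with pointwise multiplication and the topology induced from the Tychonoff product topology on $\prod_{k\in\mathbb R}T$ (pointwise convergence). It is a compact Hausdorff commutative group, and $\mu_0$ is its normalized Haar measure. Ergodicity of $\mu_0$ with respect to the action means: every measurable set $A\subset\bar{\mathbb R}$ such that, for every $\lambda\in\mathbb R\setminus\{0\}$, $\lambda^*A$ equals $A$ up to a set of $\mu_0$-measure zero, satisfies $\mu_0(A)\in\{0,1\}$; equivalently, the only elements of $L^2(\bar{\mathbb R},\mu_0)$ invariant under the induced action of all $\lambda\in\mathbb R\setminus\{0\}$ are the ($\mu_0$-a.e.) constant functions. *)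

theory Defs
  imports "HOL-Probability.Probability"
begin

definition bohr :: "(real \<Rightarrow> complex) set" where
  "bohr = {x. (\<forall>k. x k \<in> sphere 0 1) \<and> (\<forall>k l. x (k + l) = x k * x l)}"

definition bohr_mult :: "(real \<Rightarrow> complex) \<Rightarrow> (real \<Rightarrow> complex) \<Rightarrow> real \<Rightarrow> complex" where
  "bohr_mult x y = (\<lambda>k. x k * y k)"

definition dilation :: "real \<Rightarrow> (real \<Rightarrow> complex) \<Rightarrow> real \<Rightarrow> complex" where
  "dilation c x = (\<lambda>k. x (c * k))"

text \<open>
  Normalized Haar measure of a compact group with carrier \<open>G\<close> and multiplication \<open>op\<close>:
  the translation-invariant regular Borel probability measure. Regularity is part of the
  definition because the group need not be metrizable, so it is not automatic for Borel measures.

  On the function type \<open>real \<Rightarrow> complex\<close> the type-class topology is the product topology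
  (pointwise convergence), so for \<open>G = bohr\<close> the measurable sets below are the Borel sets of
  its subspace topology, a larger family than the trace of the product sigma-algebra.
\<close>

definition normalized_haar_measure ::
    "'a::topological_space set \<Rightarrow> ('a \<Rightarrow> 'a \<Rightarrow> 'a) \<Rightarrow> 'a measure \<Rightarrow> bool" where
  "normalized_haar_measure G op M \<longleftrightarrow>
     sets M = sets (restrict_space borel G) \<and>
     prob_space M \<and>
     (\<forall>g\<in>G. \<forall>A\<in>sets M. emeasure M (op g ` A) = emeasure M A) \<and>
     (\<forall>A\<in>sets M. emeasure M A = (INF U\<in>{U. openin (top_of_set G) U \<and> A \<subseteq> U}. emeasure M U)) \<and>
     (\<forall>U. openin (top_of_set G) U \<longrightarrow>
        emeasure M U = (SUP K\<in>{K. compact K \<and> K \<subseteq> U}. emeasure M K))"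

definition ergodic_action :: "'g set \<Rightarrow> ('g \<Rightarrow> 'a \<Rightarrow> 'a) \<Rightarrow> 'a measure \<Rightarrow> bool" where
  "ergodic_action \<Gamma> act M \<longleftrightarrow>
     (\<forall>A\<in>sets M. (\<forall>g\<in>\<Gamma>. sym_diff (act g ` A) A \<in> null_sets M) \<longrightarrow> measure M A \<in> {0, 1})"

end

theory Submission
  imports Defs
begin

text \<open>
  The action is mixing along suitable dilations. Haar measure integrates the character \<open>x \<mapsto> x k\<close>
  to \<open>0\<close> for \<open>k \<noteq> 0\<close>, so for trigonometric polynomials \<open>f\<close> the integral of \<open>f \<cdot> (f \<circ> dilation c)\<close>
  equals the square of the integral of \<open>f\<close> for all but finitely many \<open>c\<close>. By Stone-Weierstrass and
  regularity, trigonometric polynomials approximate indicators of Borel sets in \<open>L\<^sup>1\<close>; this first shows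
  that dilations preserve the measure, and then that \<open>\<mu> A = \<mu> (A \<inter> dilation c A)\<close> is arbitrarily close to
  \<open>(\<mu> A)\<^sup>2\<close> for an invariant set \<open>A\<close>.
\<close>

section \<open>Separation axioms for the topology of pointwise convergence\<close>

text \<open>The library has the separation axioms on function spaces only through metrizability, for
  countable domains. Declaring the \<open>t2_space\<close> arity alone would conflict with the induced arities
  of its superclasses.\<close>

instance "fun" :: (type, t0_space) t0_space
proof
  fix x y :: "'a \<Rightarrow> 'b"
  assume "x \<noteq> y"
  then obtain k where k: "x k \<noteq> y k" by blast
  then obtain U where U: "open U" "\<not> (x k \<in> U \<longleftrightarrow> y k \<in> U)"
    using t0_space_class.t0_space[OF k] by blast
  have "open ((\<lambda>f :: 'a \<Rightarrow> 'b. f k) -` U)"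
    using U by (auto intro!: open_vimage)
  then show "\<exists>U. open U \<and> \<not> (x \<in> U \<longleftrightarrow> y \<in> U)"
    using U by (intro exI[of _ "(\<lambda>f. f k) -` U"]) auto
qed

instance "fun" :: (type, t1_space) t1_space
proof
  fix x y :: "'a \<Rightarrow> 'b"
  assume "x \<noteq> y"
  then obtain k where k: "x k \<noteq> y k" by blast
  then obtain U where U: "open U" "x k \<in> U" "y k \<notin> U"
    using t1_space[OF k] by blast
  have "open ((\<lambda>f :: 'a \<Rightarrow> 'b. f k) -` U)"
    using U by (auto intro!: open_vimage)
  then show "\<exists>U. open U \<and> x \<in> U \<and> y \<notin> U"
    using U by (intro exI[of _ "(\<lambda>f. f k) -` U"]) auto
qed

instance "fun" :: (type, t2_space) t2_space
proof
  fix x y :: "'a \<Rightarrow> 'b"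
  assume "x \<noteq> y"
  then obtain k where k: "x k \<noteq> y k" by blast
  then obtain U V where UV: "open U" "open V" "x k \<in> U" "y k \<in> V" "U \<inter> V = {}"
    using hausdorff[OF k] by blast
  have "open ((\<lambda>f :: 'a \<Rightarrow> 'b. f k) -` U)" "open ((\<lambda>f :: 'a \<Rightarrow> 'b. f k) -` V)"
    using UV by (auto intro!: open_vimage)
  then show "\<exists>U V. open U \<and> open V \<and> x \<in> U \<and> y \<in> V \<and> U \<inter> V = {}"
    using UV by (intro exI[of _ "(\<lambda>f. f k) -` U"] exI[of _ "(\<lambda>f. f k) -` V"]) auto
qed

section \<open>The compact group\<close>

lemma norm_bohr: "x \<in> bohr \<Longrightarrow> norm (x k) = 1"
  by (simp add: bohr_def)

lemma bohr_add: "x \<in> bohr \<Longrightarrow> x (k + l) = x k * x l"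
  by (simp add: bohr_def)

lemma bohr_0: assumes "x \<in> bohr" shows "x 0 = 1"
  using bohr_add[OF assms, of 0 0] norm_bohr[OF assms, of 0] by auto

lemma bohr_minus: assumes "x \<in> bohr" shows "x (- k) = cnj (x k)"
proof -
  have "x k * x (- k) = 1"
    using bohr_add[OF assms, of k "- k"] bohr_0[OF assms] by simp
  moreover have "x k * cnj (x k) = 1"
    using norm_bohr[OF assms, of k] by (simp add: complex_norm_square[symmetric])
  ultimately show ?thesis
    by (metis mult_cancel_left mult_zero_left zero_neq_one)
qed

lemma closed_bohr: "closed bohr"
proof -
  have c: "continuous_on UNIV (\<lambda>x :: real \<Rightarrow> complex. x k)" for k
    by simp
  have "bohr = (\<Inter>k. (\<lambda>x. x k) -` sphere 0 1) \<inter> (\<Inter>k. \<Inter>l. {x. x (k + l) = x k * x l})"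
    by (simp add: bohr_def set_eq_iff)
  moreover have "closed \<dots>"
    by (intro closed_Int closed_INT ballI closed_vimage closed_Collect_eq continuous_on_mult c closed_sphere)
  ultimately show ?thesis by simp
qed

text \<open>Tychonoff: a product of circles is compact, and \<open>bohr\<close> is a closed subset
  of it.\<close>

lemma compact_bohr: "compact bohr"
proof -
  have "compactin (product_topology (\<lambda>k :: real. euclidean :: complex topology) UNIV)
          (\<Pi>\<^sub>E k\<in>UNIV. sphere 0 1)"
    by (subst compactin_PiE) auto
  then have "compact (\<Pi>\<^sub>E k\<in>(UNIV :: real set). sphere (0 :: complex) 1)"
    by (simp add: euclidean_product_topology)
  moreover have "bohr \<inter> (\<Pi>\<^sub>E k\<in>(UNIV :: real set). sphere (0 :: complex) 1) = bohr"
    by (auto simp: bohr_def PiE_def)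
  ultimately show ?thesis
    using closed_Int_compact[OF closed_bohr] by metis
qed

lemma dilation_bohr: "x \<in> bohr \<Longrightarrow> dilation c x \<in> bohr"
  by (auto simp: bohr_def dilation_def distrib_left)

lemma dilation_dilation: "dilation c (dilation d x) = dilation (c * d) x"
  by (simp add: dilation_def fun_eq_iff mult.commute mult.left_commute)

lemma dilation_1: "dilation 1 x = x"
  by (simp add: dilation_def)

lemma bohr_mult_bohr: "x \<in> bohr \<Longrightarrow> y \<in> bohr \<Longrightarrow> bohr_mult x y \<in> bohr"
  by (auto simp: bohr_def bohr_mult_def norm_mult)

text \<open>The continuous characters are enough to prescribe the value at one nonzero frequency;
  \<open>integral_character\<close> uses this.\<close>

lemma cis_in_bohr: "(\<lambda>t. cis (c * t)) \<in> bohr"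
  by (simp add: bohr_def cis_mult distrib_left)

lemma continuous_on_coordinate: "continuous_on S (\<lambda>x :: 'a \<Rightarrow> 'b :: topological_space. x k)"
  by (rule continuous_on_subset[OF continuous_on_product_coordinates subset_UNIV])

lemma continuous_on_dilation: "continuous_on S (dilation c)"
  unfolding dilation_def
  by (intro continuous_on_coordinatewise_then_product continuous_on_coordinate)

lemma continuous_on_bohr_mult: "continuous_on S (bohr_mult g)"
  unfolding bohr_mult_def
  by (intro continuous_on_coordinatewise_then_product continuous_on_mult continuous_on_const
      continuous_on_coordinate)

text \<open>Dilations by \<open>c\<close> and \<open>1 / c\<close> are mutually inverse. Ergodicity
  is phrased with images, while measurability and pushforwards speak of preimages.\<close>

lemma dilation_image_eq_vimage:
  assumes "c \<noteq> 0" "A \<subseteq> bohr"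
  shows "dilation c ` A = dilation (1 / c) -` A \<inter> bohr"
proof (intro equalityI subsetI)
  fix x assume "x \<in> dilation c ` A"
  then show "x \<in> dilation (1 / c) -` A \<inter> bohr"
    using assms by (auto simp: dilation_dilation dilation_1 intro: dilation_bohr)
next
  fix x assume "x \<in> dilation (1 / c) -` A \<inter> bohr"
  then have "x = dilation c (dilation (1 / c) x)" "dilation (1 / c) x \<in> A"
    using assms by (auto simp: dilation_dilation dilation_1)
  then show "x \<in> dilation c ` A" by (metis image_eqI)
qed

section \<open>Trigonometric polynomials\<close>

text \<open>Evaluations at real frequencies are characters of \<open>bohr\<close>. Since
  \<open>a = 0\<close> is allowed, these are all finite linear combinations, including zero.\<close>

inductive_set trig_poly :: "((real \<Rightarrow> complex) \<Rightarrow> complex) set" where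
  monom: "(\<lambda>x. a * x k) \<in> trig_poly"
| add: "p \<in> trig_poly \<Longrightarrow> q \<in> trig_poly \<Longrightarrow> (\<lambda>x. p x + q x) \<in> trig_poly"

lemma continuous_on_trig_poly: "p \<in> trig_poly \<Longrightarrow> continuous_on S p"
proof (induction rule: trig_poly.induct)
  case (monom a k)
  then show ?case
    by (intro continuous_on_mult continuous_on_const continuous_on_coordinate)
qed (rule continuous_on_add)

text \<open>By the morphism law, evaluations at \<open>k\<close> and \<open>l\<close> multiply to
  evaluation at \<open>k + l\<close>. This law holds only on \<open>bohr\<close>, hence the
  restriction of the equation to that set.\<close>

lemma trig_poly_mult:
  assumes "p \<in> trig_poly" "q \<in> trig_poly"
  shows "\<exists>r\<in>trig_poly. \<forall>x\<in>bohr. r x = p x * q x"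
  using assms(1)
proof (induction rule: trig_poly.induct)
  case (monom a k)
  show ?case
    using assms(2)
  proof (induction rule: trig_poly.induct)
    case (monom b l)
    show ?case
      by (rule bexI[OF _ trig_poly.monom[of "a * b" "k + l"]]) (simp add: bohr_add)
  next
    case (add q q')
    then obtain r r' where "r \<in> trig_poly" "r' \<in> trig_poly"
      "\<forall>x\<in>bohr. r x = a * x k * q x" "\<forall>x\<in>bohr. r' x = a * x k * q' x" by blast
    then show ?case
      by (intro bexI[OF _ trig_poly.add[of r r']]) (auto simp: distrib_left)
  qed
next
  case (add p p')
  then obtain r r' where "r \<in> trig_poly" "r' \<in> trig_poly"
    "\<forall>x\<in>bohr. r x = p x * q x" "\<forall>x\<in>bohr. r' x = p' x * q x" by blast
  then show ?case
    by (intro bexI[OF _ trig_poly.add[of r r']]) (auto simp: distrib_right)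
qed

text \<open>The real-valued form of Stone-Weierstrass calls for real functions. Only values on
  \<open>bohr\<close> are constrained, so that products stay in the class.\<close>

definition real_trig_poly :: "((real \<Rightarrow> complex) \<Rightarrow> real) set" where
  "real_trig_poly = {f. \<exists>p\<in>trig_poly. \<forall>x\<in>bohr. p x = complex_of_real (f x)}"

lemma real_trig_poly_separates:
  assumes "x \<in> bohr" "y \<in> bohr" "x \<noteq> y"
  shows "\<exists>f\<in>real_trig_poly. f x \<noteq> f y"
proof -
  obtain k where k: "x k \<noteq> y k" using assms(3) by blast
  \<comment> \<open>On \<open>bohr\<close> the conjugate of \<open>z k\<close> is
    \<open>z (- k)\<close>, so real and imaginary parts are combinations of the frequencies
    \<open>k\<close> and \<open>- k\<close>.\<close>
  have "(\<lambda>z. Re (z k)) \<in> real_trig_poly"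
    unfolding real_trig_poly_def mem_Collect_eq
    by (rule bexI[OF _ trig_poly.add[OF trig_poly.monom[of "1/2" k] trig_poly.monom[of "1/2" "- k"]]])
       (auto simp: bohr_minus complex_eq_iff)
  moreover have "(\<lambda>z. Im (z k)) \<in> real_trig_poly"
    unfolding real_trig_poly_def mem_Collect_eq
    by (rule bexI[OF _ trig_poly.add[OF trig_poly.monom[of "- \<i>/2" k] trig_poly.monom[of "\<i>/2" "- k"]]])
       (auto simp: bohr_minus complex_eq_iff)
  ultimately show ?thesis
    using k bexI[of "\<lambda>f. f x \<noteq> f y"] by (metis complex_eqI)
qed

interpretation real_trig_poly: function_ring_on real_trig_poly bohr
proof
  fix f assume "f \<in> real_trig_poly"
  then obtain p where "p \<in> trig_poly" and p: "\<forall>x\<in>bohr. p x = of_real (f x)"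
    by (auto simp: real_trig_poly_def)
  then have "continuous_on bohr (\<lambda>x. Re (p x))"
    by (intro continuous_on_Re continuous_on_trig_poly)
  then show "continuous_on bohr f"
    by (rule continuous_on_eq) (simp add: p)
next
  fix f g assume "f \<in> real_trig_poly" "g \<in> real_trig_poly"
  then obtain p q where pq: "p \<in> trig_poly" "\<forall>x\<in>bohr. p x = of_real (f x)"
    "q \<in> trig_poly" "\<forall>x\<in>bohr. q x = of_real (g x)"
    by (auto simp: real_trig_poly_def)
  then show "(\<lambda>x. f x + g x) \<in> real_trig_poly"
    unfolding real_trig_poly_def mem_Collect_eq
    by (intro bexI[OF _ trig_poly.add[of p q]]) auto
  show "(\<lambda>x. f x * g x) \<in> real_trig_poly"
    using trig_poly_mult[OF pq(1) pq(3)] pq by (auto simp: real_trig_poly_def)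
next
  fix c
  show "(\<lambda>_. c) \<in> real_trig_poly"
    unfolding real_trig_poly_def mem_Collect_eq
    by (rule bexI[OF _ trig_poly.monom[of "of_real c" 0]]) (simp add: bohr_0)
qed (use compact_bohr real_trig_poly_separates in auto)

section \<open>Integration against Haar measure\<close>

locale bohr_haar =
  fixes M :: "(real \<Rightarrow> complex) measure"
  assumes haar: "normalized_haar_measure bohr bohr_mult M"
begin

sublocale prob_space M
  using haar by (simp add: normalized_haar_measure_def)

lemma sets_M: "sets M = sets (restrict_space borel bohr)"
  using haar by (simp add: normalized_haar_measure_def)

lemma space_M: "space M = bohr"
  using sets_eq_imp_space_eq[OF sets_M] by (simp add: space_restrict_space)

lemma sets_subset_bohr: "A \<in> sets M \<Longrightarrow> A \<subseteq> bohr"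
  using sets.sets_into_space space_M by blast

lemma measurable_continuous_on:
  fixes f :: "(real \<Rightarrow> complex) \<Rightarrow> 'b :: topological_space"
  assumes "continuous_on bohr f"
  shows "f \<in> borel_measurable M"
  using borel_measurable_continuous_on_restrict[OF assms] measurable_cong_sets[OF sets_M refl] by blast

lemma measurable_continuous_on_self:
  assumes "continuous_on bohr f" "f \<in> bohr \<rightarrow> bohr"
  shows "f \<in> measurable M M"
proof -
  have "f \<in> measurable M (restrict_space borel bohr)"
    using assms measurable_continuous_on by (intro measurable_restrict_space2) (auto simp: space_M)
  then show ?thesis
    using measurable_cong_sets[OF refl sets_M] by blast
qed

lemma measurable_dilation [measurable]: "dilation c \<in> measurable M M"
  by (intro measurable_continuous_on_self continuous_on_dilation) (auto intro: dilation_bohr)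

lemma measurable_bohr_mult: "g \<in> bohr \<Longrightarrow> bohr_mult g \<in> measurable M M"
  by (intro measurable_continuous_on_self continuous_on_bohr_mult) (auto intro: bohr_mult_bohr)

lemma trig_poly_measurable: "p \<in> trig_poly \<Longrightarrow> p \<in> borel_measurable M"
  by (intro measurable_continuous_on continuous_on_trig_poly)

lemma integrable_continuous_on:
  fixes f :: "(real \<Rightarrow> complex) \<Rightarrow> 'b :: {banach, second_countable_topology}"
  assumes "continuous_on bohr f"
  shows "integrable M f"
proof -
  obtain B where "\<forall>x\<in>bohr. norm (f x) \<le> B"
    using compact_imp_bounded[OF compact_continuous_image[OF assms compact_bohr]]
    by (auto simp: bounded_iff)
  then show ?thesis
    by (intro integrable_const_bound[of _ B] measurable_continuous_on assms) (auto simp: space_M)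
qed

lemma integrable_trig_poly: "p \<in> trig_poly \<Longrightarrow> integrable M p"
  by (intro integrable_continuous_on continuous_on_trig_poly)

text \<open>Haar invariance is given for images of sets. Passing to the inverse translation turns it
  into a statement on preimages, hence on integrals.\<close>

lemma distr_bohr_mult:
  assumes g: "g \<in> bohr"
  shows "distr M M (bohr_mult g) = M"
proof (rule measure_eqI)
  fix A assume "A \<in> sets (distr M M (bohr_mult g))"
  then have A: "A \<in> sets M" by simp
  \<comment> \<open>The group inverse of \<open>g\<close>, because
    \<open>g k * g (- k) = g 0 = 1\<close>.\<close>
  define h where "h = (\<lambda>k. g (- k))"
  have h: "h \<in> bohr"
    using norm_bohr[OF g] bohr_add[OF g, of "- k" "- l" for k l]
    by (simp add: bohr_def h_def)
  have "g k * g (- k) = 1" for k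
    using bohr_add[OF g, of k "- k"] bohr_0[OF g] by simp
  then have inv: "bohr_mult g (bohr_mult h x) = x" "bohr_mult h (bohr_mult g x) = x" for x
    by (simp_all add: bohr_mult_def h_def mult.assoc[symmetric] mult.commute[of "g (- k)" "g k" for k])
  have B: "bohr_mult g -` A \<inter> space M \<in> sets M"
    using measurable_sets[OF measurable_bohr_mult[OF g] A] .
  have "bohr_mult g ` (bohr_mult g -` A \<inter> space M) = A"
  proof (intro equalityI subsetI)
    fix x assume "x \<in> A"
    then show "x \<in> bohr_mult g ` (bohr_mult g -` A \<inter> space M)"
      using sets_subset_bohr[OF A]
      by (intro image_eqI[of _ _ "bohr_mult h x"]) (auto simp: inv space_M intro: bohr_mult_bohr[OF h])
  qed auto
  then have "emeasure M A = emeasure M (bohr_mult g -` A \<inter> space M)"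
    using haar g B unfolding normalized_haar_measure_def by metis
  then show "emeasure (distr M M (bohr_mult g)) A = emeasure M A"
    by (simp add: emeasure_distr measurable_bohr_mult[OF g] A)
qed simp

text \<open>Translation by \<open>g\<close> multiplies the integral by \<open>g k\<close> without
  changing it, so one \<open>g\<close> with \<open>g k\<close> different from 1 forces it to
  vanish.\<close>

lemma integral_character:
  "(\<integral>x. x k \<partial>M) = (if k = 0 then 1 else 0)"
proof (cases "k = 0")
  case True
  have "(\<integral>x. x 0 \<partial>M) = (\<integral>x. (1 :: complex) \<partial>M)"
    by (rule Bochner_Integration.integral_cong) (auto simp: space_M bohr_0)
  then show ?thesis using True by (simp add: prob_space)
next
  case False
  \<comment> \<open>The slope \<open>pi / k\<close> makes \<open>g k = cis pi = -1\<close>.\<close>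
  define g where "g = (\<lambda>t. cis (pi / k * t))"
  have g: "g \<in> bohr" unfolding g_def by (rule cis_in_bohr)
  have meas: "(\<lambda>x. x k) \<in> borel_measurable M"
    using trig_poly_measurable[OF trig_poly.monom[of 1 k]] by simp
  have "(\<integral>x. x k \<partial>M) = (\<integral>x. x k \<partial>distr M M (bohr_mult g))"
    by (simp add: distr_bohr_mult[OF g])
  also have "\<dots> = (\<integral>x. g k * x k \<partial>M)"
    by (subst integral_distr[OF measurable_bohr_mult[OF g] meas]) (simp add: bohr_mult_def)
  also have "\<dots> = - (\<integral>x. x k \<partial>M)"
    using False by (simp add: g_def)
  finally show ?thesis using False by simp
qed

section \<open>Dilation invariance and decorrelation for trigonometric polynomials\<close>

lemma integral_trig_poly_dilation:
  assumes "p \<in> trig_poly" "c \<noteq> 0"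
  shows "(\<integral>x. p (dilation c x) \<partial>M) = (\<integral>x. p x \<partial>M)"
  using assms(1)
proof (induction rule: trig_poly.induct)
  case (monom a k)
  \<comment> \<open>The frequency \<open>k\<close> becomes \<open>c * k\<close>, which is zero
    exactly when \<open>k\<close> is.\<close>
  then show ?case
    using assms(2) by (simp add: dilation_def integral_character)
next
  case (add p q)
  have "integrable M (\<lambda>x. r (dilation c x))" if "r \<in> trig_poly" for r
    by (rule integrable_continuous_on[OF continuous_on_compose2[OF continuous_on_trig_poly[OF that]
          continuous_on_dilation subset_UNIV]])
  with add show ?case by (simp add: integrable_trig_poly)
qed

text \<open>Characters \<open>k\<close> and \<open>c * l\<close> are orthogonal unless \<open>k + c * l = 0\<close>, which happens for one value
  of \<open>c\<close> unless \<open>l = 0\<close>; so trigonometric polynomials decorrelate exactly outside a finite set of \<open>c\<close>.\<close>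

lemma trig_poly_mixing:
  assumes "p \<in> trig_poly" "q \<in> trig_poly"
  shows "\<exists>E. finite E \<and> (\<forall>c. c \<notin> E \<longrightarrow>
           (\<integral>x. p x * q (dilation c x) \<partial>M) = (\<integral>x. p x \<partial>M) * (\<integral>x. q x \<partial>M))"
proof -
  have int: "integrable M (\<lambda>x. r x * s (dilation c x))" if "r \<in> trig_poly" "s \<in> trig_poly" for r s c
    by (rule integrable_continuous_on[OF continuous_on_mult[OF continuous_on_trig_poly[OF that(1)]
          continuous_on_compose2[OF continuous_on_trig_poly[OF that(2)] continuous_on_dilation subset_UNIV]]])
  show ?thesis
    using assms(1)
  proof (induction rule: trig_poly.induct)
    case (monom a k)
    show ?case
      using assms(2)
    proof (induction rule: trig_poly.induct)
      case (monom b l)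
      \<comment> \<open>For \<open>l = 0\<close> the quotient is 0 by convention, so only
        \<open>c = 0\<close> is excluded. Away from the exceptional value the combined frequency
        \<open>k + c * l\<close> vanishes only if both \<open>k\<close> and \<open>l\<close> do, so
        both sides are \<open>a * b\<close> or both are 0.\<close>
      have "(\<integral>x. a * x k * (b * dilation c x l) \<partial>M) = (\<integral>x. a * x k \<partial>M) * (\<integral>x. b * x l \<partial>M)"
        if "c \<noteq> - k / l" for c
      proof -
        have "(\<integral>x. a * x k * (b * dilation c x l) \<partial>M) = (\<integral>x. a * b * x (k + c * l) \<partial>M)"
          by (rule Bochner_Integration.integral_cong) (auto simp: space_M dilation_def bohr_add)
        moreover have "k + c * l = 0 \<longleftrightarrow> k = 0 \<and> l = 0"
          using that by (cases "l = 0") (auto simp: add_eq_0_iff field_simps)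
        ultimately show ?thesis
          by (auto simp: integral_character)
      qed
      then show ?case
        by (intro exI[of _ "{- k / l}"]) auto
    next
      case (add q q')
      then obtain E E' where "finite E" "finite E'"
        "\<forall>c. c \<notin> E \<longrightarrow> (\<integral>x. a * x k * q (dilation c x) \<partial>M) = (\<integral>x. a * x k \<partial>M) * (\<integral>x. q x \<partial>M)"
        "\<forall>c. c \<notin> E' \<longrightarrow> (\<integral>x. a * x k * q' (dilation c x) \<partial>M) = (\<integral>x. a * x k \<partial>M) * (\<integral>x. q' x \<partial>M)"
        by blast
      then show ?case
        using add.hyps int[OF trig_poly.monom[of a k]]
        by (intro exI[of _ "E \<union> E'"])
           (simp add: distrib_left integrable_trig_poly del: integral_mult_right_zero integral_mult_left_zero)
    qed
  next
    case (add p p')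
    then obtain E E' where "finite E" "finite E'"
      "\<forall>c. c \<notin> E \<longrightarrow> (\<integral>x. p x * q (dilation c x) \<partial>M) = (\<integral>x. p x \<partial>M) * (\<integral>x. q x \<partial>M)"
      "\<forall>c. c \<notin> E' \<longrightarrow> (\<integral>x. p' x * q (dilation c x) \<partial>M) = (\<integral>x. p' x \<partial>M) * (\<integral>x. q x \<partial>M)"
      by blast
    then show ?case
      using add.hyps int[OF _ assms(2)]
      by (intro exI[of _ "E \<union> E'"]) (simp add: distrib_right integrable_trig_poly)
  qed
qed

lemma integrable_real_trig_poly: "f \<in> real_trig_poly \<Longrightarrow> integrable M f"
  by (intro integrable_continuous_on real_trig_poly.continuous)

lemma integral_of_real_trig_poly:
  assumes "\<forall>x\<in>bohr. p x = complex_of_real (f x)"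
  shows "(\<integral>x. p x \<partial>M) = complex_of_real (\<integral>x. f x \<partial>M)"
proof -
  have "(\<integral>x. p x \<partial>M) = (\<integral>x. complex_of_real (f x) \<partial>M)"
    using assms by (intro Bochner_Integration.integral_cong) (auto simp: space_M)
  then show ?thesis by simp
qed

lemma integral_real_trig_poly_dilation:
  assumes "f \<in> real_trig_poly" "c \<noteq> 0"
  shows "(\<integral>x. f (dilation c x) \<partial>M) = (\<integral>x. f x \<partial>M)"
proof -
  obtain p where p: "p \<in> trig_poly" "\<forall>x\<in>bohr. p x = of_real (f x)"
    using assms by (auto simp: real_trig_poly_def)
  have "complex_of_real (\<integral>x. f (dilation c x) \<partial>M) = (\<integral>x. p (dilation c x) \<partial>M)"
    using p by (intro integral_of_real_trig_poly[symmetric]) (auto intro: dilation_bohr)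
  also have "\<dots> = complex_of_real (\<integral>x. f x \<partial>M)"
    using integral_trig_poly_dilation[OF p(1) assms(2)] integral_of_real_trig_poly[OF p(2)] by simp
  finally show ?thesis by simp
qed

text \<open>The exceptional set together with 0 is finite, so some real \<open>c\<close> lies
  outside it and belongs to the acting group.\<close>

lemma real_trig_poly_mixing:
  assumes "f \<in> real_trig_poly"
  shows "\<exists>c. c \<noteq> 0 \<and> (\<integral>x. f x * f (dilation c x) \<partial>M) = (\<integral>x. f x \<partial>M)\<^sup>2"
proof -
  obtain p where p: "p \<in> trig_poly" "\<forall>x\<in>bohr. p x = of_real (f x)"
    using assms by (auto simp: real_trig_poly_def)
  obtain E where E: "finite E" and mixing: "\<And>c. c \<notin> E \<Longrightarrow>
      (\<integral>x. p x * p (dilation c x) \<partial>M) = (\<integral>x. p x \<partial>M) * (\<integral>x. p x \<partial>M)"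
    using trig_poly_mixing[OF p(1) p(1)] by blast
  obtain c where c: "c \<notin> insert 0 E"
    using ex_new_if_finite[OF infinite_UNIV_char_0, of "insert 0 E"] E by auto
  have "complex_of_real (\<integral>x. f x * f (dilation c x) \<partial>M) = (\<integral>x. p x * p (dilation c x) \<partial>M)"
    using p by (intro integral_of_real_trig_poly[symmetric]) (auto intro: dilation_bohr)
  also have "\<dots> = complex_of_real ((\<integral>x. f x \<partial>M)\<^sup>2)"
    using mixing[of c] c integral_of_real_trig_poly[OF p(2)] by (simp add: power2_eq_square)
  finally show ?thesis using c by (intro exI[of _ c]) (simp only: of_real_eq_iff insert_iff, simp)
qed

section \<open>Approximation and invariance\<close>

lemma open_approx:
  assumes A: "A \<in> sets M" and "e > 0"
  shows "\<exists>U. openin (top_of_set bohr) U \<and> A \<subseteq> U \<and> measure M U < measure M A + e"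
proof -
  let ?S = "{U. openin (top_of_set bohr) U \<and> A \<subseteq> U}"
  have "(INF U\<in>?S. emeasure M U) = emeasure M A"
    using haar A unfolding normalized_haar_measure_def by simp
  also have "\<dots> < ennreal (measure M A + e)"
    using \<open>e > 0\<close> by (simp add: emeasure_eq_measure ennreal_less_iff)
  finally obtain U where "U \<in> ?S" "emeasure M U < ennreal (measure M A + e)"
    unfolding INF_less_iff by blast
  then show ?thesis
    by (intro exI[of _ U]) (simp add: emeasure_eq_measure ennreal_less_iff)
qed

lemma openin_sets:
  assumes "openin (top_of_set bohr) U"
  shows "U \<in> sets M"
  using assms by (auto simp: openin_open sets_M sets_restrict_space)

lemma closed_diff_openin:
  assumes "openin (top_of_set bohr) U"
  shows "closed (bohr - U)"
  using closedin_closed_trans[OF closedin_diff[OF closedin_topspace assms]] closed_bohr by simp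

text \<open>Outer regularity applied to the complement: the complement in \<open>bohr\<close> of a
  relatively open set is closed, since \<open>bohr\<close> is.\<close>

lemma closed_approx:
  assumes A: "A \<in> sets M" and "e > 0"
  shows "\<exists>K. closed K \<and> K \<subseteq> A \<and> measure M A - e < measure M K"
proof -
  have "bohr - A \<in> sets M"
    using A sets.compl_sets space_M by metis
  from open_approx[OF this \<open>e > 0\<close>] obtain V where
    V: "openin (top_of_set bohr) V" "bohr - A \<subseteq> V" "measure M V < measure M (bohr - A) + e"
    by blast
  have "measure M (bohr - A) = 1 - measure M A" "measure M (bohr - V) = 1 - measure M V"
    using prob_compl[OF A] prob_compl[OF openin_sets[OF V(1)]] by (simp_all add: space_M)
  with V show ?thesis
    using closed_diff_openin[OF V(1)] by (intro exI[of _ "bohr - V"]) auto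
qed

text \<open>The separation step in the proof of Stone-Weierstrass, applied to the disjoint closed
  sets \<open>bohr - U\<close> and \<open>K\<close>; the separating function is itself a
  trigonometric polynomial.\<close>

lemma urysohn_real_trig_poly:
  assumes "closed K" "K \<subseteq> U" "openin (top_of_set bohr) U" "0 < e" "e < 1"
  shows "\<exists>f\<in>real_trig_poly. f ` bohr \<subseteq> {0..1} \<and> (\<forall>x\<in>bohr - U. f x < e) \<and> (\<forall>x\<in>K. f x > 1 - e)"
  using assms openin_imp_subset[OF assms(3)]
  by (intro real_trig_poly.two closed_diff_openin) auto

section \<open>Dilations preserve Haar measure\<close>

lemma sets_dilation_image:
  assumes "c \<noteq> 0" "A \<in> sets M"
  shows "dilation c ` A \<in> sets M"
  using measurable_sets[OF measurable_dilation assms(2), of "1 / c"] assms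
  by (simp add: dilation_image_eq_vimage sets_subset_bohr space_M)

text \<open>A polynomial \<open>f\<close> that is almost 1 on a closed part of \<open>A\<close> and
  small off an open superset has the same integral as its dilate, which is almost 1 on most of the
  image. One inequality suffices, since \<open>1 / c\<close> supplies the reverse.\<close>

lemma measure_dilation_image_le:
  assumes c: "c \<noteq> 0" and A: "A \<in> sets M"
  shows "measure M (dilation c ` A) \<le> measure M A"
proof (rule field_le_epsilon)
  fix d :: real assume "d > 0"
  \<comment> \<open>Regularity for \<open>L\<close> and for \<open>U\<close>, the bound on
    \<open>f\<close> off \<open>U\<close>, and the factor \<open>1 - e\<close> each cost at most
    \<open>e\<close>, in total \<open>4 * e\<close>. The cap 1/2 ensures
    \<open>e < 1\<close>.\<close>
  define e where "e = min (d / 4) (1 / 2)"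
  have e: "0 < e" "e < 1" "4 * e \<le> d" using \<open>d > 0\<close> by (auto simp: e_def)
  obtain U where U: "openin (top_of_set bohr) U" "A \<subseteq> U" "measure M U < measure M A + e"
    using open_approx[OF A e(1)] by blast
  obtain L where L: "closed L" "L \<subseteq> dilation c ` A" "measure M (dilation c ` A) - e < measure M L"
    using closed_approx[OF sets_dilation_image[OF c A] e(1)] by blast
  define K where "K = dilation (1 / c) ` L"
  have Lb: "L \<subseteq> bohr" using L sets_subset_bohr[OF sets_dilation_image[OF c A]] by blast
  \<comment> \<open>Compactness passes to the continuous image; the Hausdorff property then makes
    \<open>K\<close> closed.\<close>
  have "compact K"
    unfolding K_def using compact_Int_closed[OF compact_bohr L(1)] Lb
    by (intro compact_continuous_image continuous_on_dilation) (simp add: inf_absorb2)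
  moreover have "K \<subseteq> A"
    unfolding K_def using L(2) dilation_image_eq_vimage[OF c sets_subset_bohr[OF A]] by auto
  ultimately have "closed K" "K \<subseteq> U"
    using U(2) by (auto intro: compact_imp_closed)
  then obtain f where f: "f \<in> real_trig_poly" "f ` bohr \<subseteq> {0..1}"
      "\<forall>x\<in>bohr - U. f x < e" "\<forall>x\<in>K. f x > 1 - e"
    using urysohn_real_trig_poly[OF _ _ U(1) e(1,2)] by blast
  have L_sets: "L \<in> sets M"
    using L(1) Lb by (auto simp: sets_M sets_restrict_space intro!: image_eqI[of _ _ L])
  have U_sets: "U \<in> sets M" using openin_sets[OF U(1)] .
  have int: "integrable M (\<lambda>x. f (dilation (1 / c) x))"
    by (intro integrable_continuous_on continuous_on_compose2[OF real_trig_poly.continuous[OF f(1)] continuous_on_dilation])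
       (auto intro: dilation_bohr)
  have "(1 - e) * measure M L = (\<integral>x. (1 - e) * indicator L x \<partial>M)"
    using L_sets by (simp add: emeasure_eq_measure)
  also have "\<dots> \<le> (\<integral>x. f (dilation (1 / c) x) \<partial>M)"
  proof (rule integral_mono[OF _ int])
    fix x assume "x \<in> space M"
    then show "(1 - e) * indicator L x \<le> f (dilation (1 / c) x)"
      using f(2,4) dilation_bohr[of x "1 / c"]
      by (auto simp: K_def space_M indicator_def intro: less_imp_le)
  qed (use L_sets in \<open>simp add: emeasure_eq_measure\<close>)
  also have "\<dots> = (\<integral>x. f x \<partial>M)"
    using integral_real_trig_poly_dilation[OF f(1)] c by simp
  also have "\<dots> \<le> (\<integral>x. indicator U x + e \<partial>M)"
  proof (rule integral_mono[OF integrable_real_trig_poly[OF f(1)]])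
    fix x assume x: "x \<in> space M"
    then have "f x \<le> 1" "x \<notin> U \<Longrightarrow> f x < e"
      using f(2,3) by (auto simp: space_M)
    then show "f x \<le> indicator U x + e"
      using e by (auto simp: indicator_def)
  qed (use U_sets in \<open>simp add: emeasure_eq_measure\<close>)
  also have "\<dots> = measure M U + e"
    using U_sets by (simp add: emeasure_eq_measure prob_space)
  finally have "measure M L \<le> measure M U + e + e * measure M L" by (simp add: algebra_simps)
  also have "e * measure M L \<le> e * 1" using e by (intro mult_left_mono) auto
  finally show "measure M (dilation c ` A) \<le> measure M A + d"
    using U(3) L(3) e(3) by simp
qed

text \<open>The inequality is used twice: dilating \<open>A\<close> by \<open>1 / c\<close>, and
  dilating the result back by \<open>c\<close>.\<close>

lemma distr_dilation:
  assumes "c \<noteq> 0"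
  shows "distr M M (dilation c) = M"
proof (rule measure_eqI)
  fix A assume "A \<in> sets (distr M M (dilation c))"
  then have A: "A \<in> sets M" by simp
  let ?B = "dilation (1 / c) ` A"
  have "dilation c ` ?B = A"
    using assms by (simp add: image_image dilation_dilation dilation_1)
  then have "measure M A \<le> measure M ?B"
    using measure_dilation_image_le[OF assms sets_dilation_image[OF _ A], of "1 / c"] assms by simp
  moreover have "measure M ?B \<le> measure M A"
    using measure_dilation_image_le[OF _ A, of "1 / c"] assms by simp
  moreover have "?B = dilation c -` A \<inter> space M"
    using dilation_image_eq_vimage[OF _ sets_subset_bohr[OF A], of "1 / c"] assms by (simp add: space_M)
  ultimately show "emeasure (distr M M (dilation c)) A = emeasure M A"
    using A by (simp add: emeasure_distr emeasure_eq_measure)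
qed simp

section \<open>Approximation of Borel sets in the mean, and ergodicity\<close>

lemma L1_approx:
  assumes A: "A \<in> sets M" and "e > 0"
  shows "\<exists>f\<in>real_trig_poly. f ` bohr \<subseteq> {0..1} \<and> (\<integral>x. \<bar>indicator A x - f x\<bar> \<partial>M) < e"
proof -
  define d where "d = min (e / 4) (1 / 2)"
  have d: "0 < d" "d < 1" "4 * d \<le> e" using \<open>e > 0\<close> by (auto simp: d_def)
  obtain U where U: "openin (top_of_set bohr) U" "A \<subseteq> U" "measure M U < measure M A + d"
    using open_approx[OF A d(1)] by blast
  obtain K where K: "closed K" "K \<subseteq> A" "measure M A - d < measure M K"
    using closed_approx[OF A d(1)] by blast
  obtain f where f: "f \<in> real_trig_poly" "f ` bohr \<subseteq> {0..1}"
      "\<forall>x\<in>bohr - U. f x < d" "\<forall>x\<in>K. f x > 1 - d"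
    using urysohn_real_trig_poly[OF K(1) _ U(1) d(1,2)] K(2) U(2) by blast
  have U_sets: "U \<in> sets M" using openin_sets[OF U(1)] .
  have K_sets: "K \<in> sets M"
    using K sets_subset_bohr[OF A] by (auto simp: sets_M sets_restrict_space intro!: image_eqI[of _ _ K])
  \<comment> \<open>The error is at most \<open>d\<close> on \<open>K\<close> and outside
    \<open>U\<close>, and at most 1 on \<open>U - K\<close>, a set of measure below
    \<open>2 * d\<close>; this gives less than \<open>3 * d\<close>.\<close>
  have "(\<integral>x. \<bar>indicator A x - f x\<bar> \<partial>M) \<le> (\<integral>x. (indicator U x - indicator K x) + d \<partial>M)"
  proof (rule integral_mono)
    show "integrable M (\<lambda>x. \<bar>indicator A x - f x\<bar>)"
      using A integrable_real_trig_poly[OF f(1)] by (simp add: emeasure_eq_measure)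
    show "integrable M (\<lambda>x. (indicator U x - indicator K x) + d)"
      using U_sets K_sets by (simp add: emeasure_eq_measure)
    fix x assume "x \<in> space M"
    then have x: "x \<in> bohr" by (simp add: space_M)
    then have "0 \<le> f x" "f x \<le> 1" using f(2) by auto
    moreover have "x \<notin> U \<Longrightarrow> f x < d" "x \<in> K \<Longrightarrow> f x > 1 - d"
      using f x by auto
    ultimately show "\<bar>indicator A x - f x\<bar> \<le> (indicator U x - indicator K x) + d"
      using K(2) U(2) d by (auto simp: indicator_def)
  qed
  also have "\<dots> = measure M U - measure M K + d"
    using U_sets K_sets by (simp add: emeasure_eq_measure prob_space)
  also have "\<dots> < e" using U(3) K(3) d by simp
  finally show ?thesis using f by blast
qed

text \<open>Invariance makes \<open>measure M A\<close> the correlation of the indicator with its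
  dilate. Replacing both factors by \<open>f\<close> costs \<open>2 * e\<close>, mixing yields the
  squared integral of \<open>f\<close>, and returning to the squared measure costs another
  \<open>2 * e\<close>.\<close>

lemma abs_measure_diff_square_le:
  assumes A: "A \<in> sets M"
    and inv: "\<And>c. c \<noteq> 0 \<Longrightarrow> sym_diff (dilation c ` A) A \<in> null_sets M"
    and e: "e > 0"
  shows "\<bar>measure M A - (measure M A)\<^sup>2\<bar> \<le> 4 * e"
proof -
  obtain f where f: "f \<in> real_trig_poly" "f ` bohr \<subseteq> {0..1}"
    and fe: "(\<integral>x. \<bar>indicator A x - f x\<bar> \<partial>M) < e"
    using L1_approx[OF A e] by blast
  obtain c where c: "c \<noteq> 0" and mixing: "(\<integral>x. f x * f (dilation c x) \<partial>M) = (\<integral>x. f x \<partial>M)\<^sup>2"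
    using real_trig_poly_mixing[OF f(1)] by blast
  let ?g = "\<lambda>x. \<bar>indicator A x - f x\<bar> :: real"
  have f01: "0 \<le> f x" "f x \<le> 1" if "x \<in> bohr" for x
    using f(2) that by auto
  have [measurable]: "f \<in> borel_measurable M" "A \<in> sets M"
    using measurable_continuous_on[OF real_trig_poly.continuous[OF f(1)]] A by auto
  have int: "integrable M ?g"
    using A integrable_real_trig_poly[OF f(1)] by (simp add: emeasure_eq_measure)
  have g_dilation: "integrable M (\<lambda>x. ?g (dilation c x))"
    "(\<integral>x. ?g (dilation c x) \<partial>M) = (\<integral>x. ?g x \<partial>M)"
  proof -
    show "integrable M (\<lambda>x. ?g (dilation c x))"
      using integrable_distr[of "dilation c" M M ?g] int distr_dilation[OF c] by simp
    show "(\<integral>x. ?g (dilation c x) \<partial>M) = (\<integral>x. ?g x \<partial>M)"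
      using integral_distr[of "dilation c" M M ?g] distr_dilation[OF c] by simp
  qed
  \<comment> \<open>The points \<open>x\<close> of \<open>bohr\<close> with
    \<open>dilation c x\<close> in \<open>A\<close> form the image of \<open>A\<close> under
    dilation by \<open>1 / c\<close>, hence invariance at \<open>1 / c\<close>.\<close>
  have "sym_diff (dilation (1 / c) ` A) A \<in> null_sets M"
    using inv[of "1 / c"] c by simp
  then have "AE x in M. x \<notin> sym_diff (dilation (1 / c) ` A) A"
    by (rule AE_not_in)
  then have AE: "AE x in M. indicator A x * indicator A (dilation c x) = (indicator A x :: real)"
    using AE_space
  proof eventually_elim
    case (elim x)
    then show ?case
      using dilation_image_eq_vimage[OF _ sets_subset_bohr[OF A], of "1 / c"] c
      by (auto simp: indicator_def space_M)
  qed
  have intAA: "integrable M (\<lambda>x. indicator A x * indicator A (dilation c x) :: real)"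
    by (rule integrable_const_bound[of _ 1]) (auto simp: indicator_def)
  have intff: "integrable M (\<lambda>x. f x * f (dilation c x))"
    by (intro integrable_continuous_on continuous_on_mult real_trig_poly.continuous[OF f(1)]
        continuous_on_compose2[OF real_trig_poly.continuous[OF f(1)] continuous_on_dilation])
       (auto intro: dilation_bohr)
  have "measure M A = (\<integral>x. indicator A x * indicator A (dilation c x) \<partial>M)"
    using integral_cong_AE[OF _ _ AE] by simp
  then have "measure M A - (\<integral>x. f x \<partial>M)\<^sup>2 =
      (\<integral>x. indicator A x * indicator A (dilation c x) - f x * f (dilation c x) \<partial>M)"
    using intAA intff by (simp add: mixing)
  also have "\<bar>\<dots>\<bar> \<le> (\<integral>x. \<bar>indicator A x * indicator A (dilation c x) - f x * f (dilation c x)\<bar> \<partial>M)"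
    by (rule integral_abs_bound)
  also have "\<dots> \<le> (\<integral>x. ?g x + ?g (dilation c x) \<partial>M)"
  proof (rule integral_mono)
    fix x assume "x \<in> space M"
    then have "x \<in> bohr" "dilation c x \<in> bohr" by (auto simp: space_M intro: dilation_bohr)
    note b = f01[OF this(1)] f01[OF this(2)]
    \<comment> \<open>The two factors are exchanged one at a time; the factor kept in each term lies
      in [0, 1].\<close>
    have "\<bar>indicator A x * indicator A (dilation c x) - f x * f (dilation c x)\<bar>
        = \<bar>(indicator A x - f x) * indicator A (dilation c x) + f x * (indicator A (dilation c x) - f (dilation c x))\<bar>"
      by (simp add: algebra_simps)
    also have "\<dots> \<le> ?g x * indicator A (dilation c x) + f x * ?g (dilation c x)"
      by (rule order_trans[OF abs_triangle_ineq]) (use b in \<open>simp add: abs_mult\<close>)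
    also have "\<dots> \<le> ?g x * 1 + 1 * ?g (dilation c x)"
      using b by (intro add_mono mult_left_mono mult_right_mono) (simp_all add: indicator_le_1)
    finally show "\<bar>indicator A x * indicator A (dilation c x) - f x * f (dilation c x)\<bar> \<le> ?g x + ?g (dilation c x)"
      by simp
  qed (use intAA intff int g_dilation in auto)
  also have "\<dots> = (\<integral>x. ?g x \<partial>M) + (\<integral>x. ?g x \<partial>M)"
    using int g_dilation by simp
  finally have 1: "\<bar>measure M A - (\<integral>x. f x \<partial>M)\<^sup>2\<bar> \<le> 2 * e" using fe by simp
  have "measure M A - (\<integral>x. f x \<partial>M) = (\<integral>x. indicator A x - f x \<partial>M)"
    using integrable_real_trig_poly[OF f(1)] by (simp add: emeasure_eq_measure)
  also have "\<bar>\<dots>\<bar> \<le> (\<integral>x. ?g x \<partial>M)"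
    by (rule integral_abs_bound)
  finally have 2: "\<bar>measure M A - (\<integral>x. f x \<partial>M)\<bar> \<le> e" using fe by simp
  have "0 \<le> (\<integral>x. f x \<partial>M)"
    using f01 by (intro integral_nonneg_AE AE_I2) (simp add: space_M)
  moreover have "(\<integral>x. f x \<partial>M) \<le> 1"
    using f01 integrable_real_trig_poly[OF f(1)] by (intro integral_le_const) (auto simp: space_M)
  \<comment> \<open>The difference of squares factors as difference times sum, with the sum at most
    2.\<close>
  ultimately have "\<bar>measure M A + (\<integral>x. f x \<partial>M)\<bar> \<le> 2"
    using prob_le_1[of A] measure_nonneg[of M A] by linarith
  then have "\<bar>measure M A - (\<integral>x. f x \<partial>M)\<bar> * \<bar>measure M A + (\<integral>x. f x \<partial>M)\<bar> \<le> e * 2"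
    using 2 e by (intro mult_mono) auto
  then have "\<bar>(measure M A)\<^sup>2 - (\<integral>x. f x \<partial>M)\<^sup>2\<bar> \<le> 2 * e"
    by (simp add: power2_eq_square abs_mult[symmetric] algebra_simps)
  with 1 show ?thesis by linarith
qed

end

theorem proposition2:
  fixes \<mu>0 :: "(real \<Rightarrow> complex) measure"
  assumes "normalized_haar_measure bohr bohr_mult \<mu>0"
  shows "ergodic_action (UNIV - {0 :: real}) dilation \<mu>0"
  unfolding ergodic_action_def
proof (intro ballI impI)
  interpret bohr_haar \<mu>0 by standard (rule assms)
  fix A assume A: "A \<in> sets \<mu>0"
    and inv: "\<forall>c\<in>UNIV - {0}. sym_diff (dilation c ` A) A \<in> null_sets \<mu>0"
  have "\<bar>measure \<mu>0 A - (measure \<mu>0 A)\<^sup>2\<bar> \<le> 0 + e" if "e > 0" for e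
    using abs_measure_diff_square_le[OF A, of "e / 4"] inv that by auto
  \<comment> \<open>The bound holds for every positive \<open>e\<close>, so the measure equals its
    own square.\<close>
  then have "measure \<mu>0 A * (1 - measure \<mu>0 A) = 0"
    using field_le_epsilon[of "\<bar>measure \<mu>0 A - (measure \<mu>0 A)\<^sup>2\<bar>" 0]
    by (simp add: power2_eq_square algebra_simps)
  then show "measure \<mu>0 A \<in> {0, 1}" by auto
qed

end
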